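(* Let $T$ be a tree of order $n\geq 4$ with $\Delta(T)\geq 3$. Suppose there exists a linear order $u_0,u_1,\dots,u_{n-1}$ of the vertices of $T$ satisfying $0=c(u_0)<c(u_1)<\dots<c(u_{n-1})$, where $c$ is the mapping defined by $$c(u_0)=0,\qquad c(u_{i+1})=c(u_i)+n-1-\mathcal{L}(u_i)-\mathcal{L}(u_{i+1})-\varepsilon(T),\quad 0\leq i\leq n-2,$$ and such that: 1. $u_0=w$ and $u_{n-1}\in N(w)$ when $C(T)=\{w\}$; and $\{u_0,u_{n-1}\}=\{w,w'\}$ when $C(T)=\{w,w'\}$; 2. when $C(T)=\{w\}$, $u_i$ and $u_{i+1}$ are in different branches for all $1\leq i\leq n-2$; when $C(T)=\{w,w'\}$, $u_i$ and $u_{i+1}$ are in opposite branches for all $0\leq i\leq n-2$, where a central vertex is counted as lying on its own side (i.e. the path from $u_i$ to $u_{i+1}$ contains the edge $ww'$); 3. $D(u_i,u_{i+1})\leq n/2$ for $0\leq i\leq n-2$. Then $$hc(T)=(n-1)(n-1-\varepsilon(T))+\varepsilon'(T)-2\mathcal{L}(T).$$ Moreover, under these conditions the mapping $c$ above is an optimal hamiltonian coloring of $T$, i.e. a hamiltonian coloring whose maximum color equals $hc(T)$.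
   Context: For a connected graph $G$ of order $n$ (finite, simple), $D(u,v)$ denotes the detour distance between vertices $u,v$, i.e. the length of a longest $u,v$-path in $G$ (for a tree this is the ordinary distance). A hamiltonian coloring of $G$ is a map $c: V(G)\to\{0,1,2,\dots\}$ such that $D(u,v)+|c(u)-c(v)|\geq n-1$ for every two distinct vertices $u,v$. The value $hc(c)$ is the maximum color assigned by $c$, and the hamiltonian chromatic number $hc(G)$ is the minimum of $hc(c)$ over all hamiltonian colorings $c$ of $G$ (note that the color $0$ is allowed). For a tree $T$, the center $C(T)$ is the set of vertices of minimum eccentricity; it consists of either one vertex $w$ or two adjacent vertices $w,w'$ (the central vertex/vertices). $T$ is viewed as rooted at its central vertex, or at both central vertices (both at level $0$). A vertex $v$ is a descendent of $u$ if $u$ lies on the path joining $v$ to the (nearest) central vertex. For $u\notin C(T)$ adjacent to a central vertex, the subtree induced by $u$ and all its descendents is called the branch at $u$. Two branches are different if they are at two (distinct) vertices adjacent to the same central vertex, and opposite if they are at two vertices adjacent to different central vertices. $N(w)$ is the set of neighbours of $w$, and $\Delta(T)$ is the maximum degree. For $u\in V(T)$ put $\mathcal{L}(u)=\min\{D(u,w): w\in C(T)\}$ and $\mathcal{L}(T)=\sum_{u\in V(T)}\mathcal{L}(u)$. Put $\varepsilon(T)=0$ if $|C(T)|=1$, $\varepsilon(T)=1$ if $|C(T)|=2$, and $\varepsilon'(T)=1-\varepsilon(T)$. *)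

theory Defs
  imports "Graph_Theory.Graph_Theory"
begin

text \<open>
  A finite simple graph is a \<open>pair_graph\<close>: every edge is present as two opposite
  arcs. A path is an \<open>apath\<close>, a list of consecutive arcs without repeated
  vertices; its length is the number of its arcs.
\<close>

abbreviation path_betw :: "'a pair_pre_digraph \<Rightarrow> 'a \<Rightarrow> ('a \<times> 'a) list \<Rightarrow> 'a \<Rightarrow> bool" where
  "path_betw G u p v \<equiv> pre_digraph.apath (with_proj G) u p v"

abbreviation path_verts :: "'a pair_pre_digraph \<Rightarrow> 'a \<Rightarrow> ('a \<times> 'a) list \<Rightarrow> 'a set" where
  "path_verts G u p \<equiv> set (pre_digraph.awalk_verts (with_proj G) u p)"

text \<open>
  The library predicate \<open>tree\<close> is unsuitable for undirected graphs: in a symmetric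
  digraph, the closed walk along an edge and back already is a \<open>cycle\<close>. Cycles of
  length at least 3 are exactly those of the undirected graph.
\<close>

definition undirected_tree :: "'a pair_pre_digraph \<Rightarrow> bool" where
  "undirected_tree G \<longleftrightarrow>
     pair_graph G \<and> Digraph_Component.connected (with_proj G) \<and>
     \<not> (\<exists>p. pre_digraph.cycle (with_proj G) p \<and> 3 \<le> length p)"

definition order :: "'a pair_pre_digraph \<Rightarrow> nat" where
  "order G = card (pverts G)"

definition nbrs :: "'a pair_pre_digraph \<Rightarrow> 'a \<Rightarrow> 'a set" where
  "nbrs G v = {u. (v, u) \<in> parcs G}"

definition max_degree :: "'a pair_pre_digraph \<Rightarrow> nat" where
  "max_degree G = Max ((\<lambda>v. card (nbrs G v)) ` pverts G)"

definition detour_dist :: "'a pair_pre_digraph \<Rightarrow> 'a \<Rightarrow> 'a \<Rightarrow> nat" where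
  "detour_dist G u v = Max {length p | p. path_betw G u p v}"

definition hamiltonian_coloring :: "'a pair_pre_digraph \<Rightarrow> ('a \<Rightarrow> nat) \<Rightarrow> bool" where
  "hamiltonian_coloring G c \<longleftrightarrow>
     (\<forall>u\<in>pverts G. \<forall>v\<in>pverts G. u \<noteq> v \<longrightarrow>
        int (detour_dist G u v) + \<bar>int (c u) - int (c v)\<bar> \<ge> int (order G) - 1)"

definition hc_value :: "'a pair_pre_digraph \<Rightarrow> ('a \<Rightarrow> nat) \<Rightarrow> nat" where
  "hc_value G c = Max (c ` pverts G)"

definition hc :: "'a pair_pre_digraph \<Rightarrow> nat" where
  "hc G = (LEAST k. \<exists>c. hamiltonian_coloring G c \<and> hc_value G c = k)"

definition graph_dist :: "'a pair_pre_digraph \<Rightarrow> 'a \<Rightarrow> 'a \<Rightarrow> nat" where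
  "graph_dist G u v = Min {length p | p. path_betw G u p v}"

definition eccentricity :: "'a pair_pre_digraph \<Rightarrow> 'a \<Rightarrow> nat" where
  "eccentricity G u = Max (graph_dist G u ` pverts G)"

definition center :: "'a pair_pre_digraph \<Rightarrow> 'a set" where
  "center G = {u \<in> pverts G. \<forall>v\<in>pverts G. eccentricity G u \<le> eccentricity G v}"

definition level :: "'a pair_pre_digraph \<Rightarrow> 'a \<Rightarrow> nat" where
  "level T u = Min (detour_dist T u ` center T)"

definition total_level :: "'a pair_pre_digraph \<Rightarrow> nat" where
  "total_level T = (\<Sum>u\<in>pverts T. level T u)"

definition eps :: "'a pair_pre_digraph \<Rightarrow> nat" where
  "eps T = (if card (center T) = 1 then 0 else 1)"

definition eps' :: "'a pair_pre_digraph \<Rightarrow> nat" where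
  "eps' T = 1 - eps T"

definition descendents :: "'a pair_pre_digraph \<Rightarrow> 'a \<Rightarrow> 'a set" where
  "descendents T u =
     {v \<in> pverts T. \<exists>z\<in>center T. detour_dist T v z = level T v \<and>
        (\<exists>p. path_betw T v p z \<and> u \<in> path_verts T v p)}"

text \<open>Every vertex is a descendent of itself, so \<open>u\<close> belongs to the branch at \<open>u\<close>.\<close>

definition branch :: "'a pair_pre_digraph \<Rightarrow> 'a \<Rightarrow> ('a, 'a \<times> 'a) pre_digraph" where
  "branch T u = with_proj T \<restriction> descendents T u"

definition in_different_branches :: "'a pair_pre_digraph \<Rightarrow> 'a \<Rightarrow> 'a \<Rightarrow> bool" where
  "in_different_branches T a b \<longleftrightarrow>
     (\<exists>z\<in>center T. \<exists>x\<in>nbrs T z - center T. \<exists>y\<in>nbrs T z - center T. x \<noteq> y \<and>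
        a \<in> verts (branch T x) \<and> b \<in> verts (branch T y))"

text \<open>
  Side of a central vertex \<open>z\<close>: all branches at neighbours of \<open>z\<close>, together with \<open>z\<close>
  itself. Hence \<open>in_opposite_branches\<close> also covers pairs in which one or both
  vertices are central.
\<close>

definition central_side :: "'a pair_pre_digraph \<Rightarrow> 'a \<Rightarrow> 'a set" where
  "central_side T z = insert z (\<Union>x\<in>nbrs T z - center T. verts (branch T x))"

definition in_opposite_branches :: "'a pair_pre_digraph \<Rightarrow> 'a \<Rightarrow> 'a \<Rightarrow> bool" where
  "in_opposite_branches T a b \<longleftrightarrow>
     (\<exists>z\<in>center T. \<exists>z'\<in>center T. z \<noteq> z' \<and>
        a \<in> central_side T z \<and> b \<in> central_side T z')"

end

theory Submission
  imports Defs
begin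

text \<open>
  In a tree the detour distance is the ordinary distance, so
  \<open>D(x, y) \<le> L(x) + L(y) + \<epsilon>\<close> by routing through the center. Sorting the vertices by
  the colors of any hamiltonian coloring and adding up the color differences of
  consecutive vertices gives the lower bound; the only correction is the sum of the
  levels of the first and the last vertex, which is at least \<open>\<epsilon>'\<close>. For the given order,
  the branch conditions turn the first inequality into an equality, so \<open>c\<close>
  attains the bound. That \<open>c\<close> is a hamiltonian coloring is immediate for consecutive
  vertices; since \<open>D(u\<^sub>i, u\<^sub>i\<^sub>+\<^sub>1) \<le> n/2\<close>, each step raises the color by at least
  \<open>(n-2)/2\<close>, hence two steps by \<open>n-2\<close> and three steps by \<open>n-1\<close>.
\<close>

text \<open>Interior indices are counted twice and the two end indices once; this is how the levels
  of the first and the last vertex enter the bound.\<close>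

lemma sum_consecutive:
  fixes f :: "nat \<Rightarrow> 'b :: comm_ring_1"
  shows "(\<Sum>i<m. f i + f (Suc i)) = 2 * (\<Sum>i<Suc m. f i) - f 0 - f m"
  by (induction m) (simp_all add: algebra_simps)

text \<open>Strong connectivity, equivalent to connectivity for symmetric arcs, yields directed
  paths between any two vertices at once. Cycles of length 2 remain: an edge walked forth and back
  is one.\<close>

locale simple_tree = pair_graph +
  assumes strongly_connected: "strongly_connected (with_proj G)"
    and no_long_cycle: "cycle p \<Longrightarrow> length p < 3"
begin

abbreviation d :: "'a \<Rightarrow> 'a \<Rightarrow> nat" where
  "d \<equiv> detour_dist G"

text \<open>Paths in a tree are unique, so the existential speaks of the one path from
  \<open>x\<close> to \<open>y\<close>; its ends are included.\<close>

definition between :: "'a \<Rightarrow> 'a \<Rightarrow> 'a \<Rightarrow> bool" where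
  "between x m y \<longleftrightarrow> (\<exists>p. apath x p y \<and> m \<in> set (awalk_verts x p))"

section \<open>Uniqueness of paths\<close>

lemma set_awalk_verts_awalk_to_apath:
  assumes "awalk x p y"
  shows "set (awalk_verts x (awalk_to_apath p)) \<subseteq> set (awalk_verts x p)"
proof -
  have "awalk x (awalk_to_apath p) y"
    by (rule awalkI_apath, rule apath_awalk_to_apath, rule assms)
  then show ?thesis
    using assms awalk_to_apath_subset[OF assms] by (auto simp: set_awalk_verts)
qed

text \<open>A walk from \<open>a\<close> to \<open>b\<close> avoiding \<open>u\<close> shortens to a
  path that closes up through \<open>u\<close> to a cycle. As \<open>a \<noteq> b\<close>, this path
  has an arc, so the cycle has length at least 3.\<close>

lemma walk_between_nbrs:
  assumes arcs: "(u, a) \<in> parcs G" "(u, b) \<in> parcs G" and "a \<noteq> b" and walk: "awalk a q b"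
  shows "u \<in> set (awalk_verts a q)"
proof (rule ccontr)
  assume u: "u \<notin> set (awalk_verts a q)"
  let ?r = "awalk_to_apath q"
  have r: "apath a ?r b" using walk by (rule apath_awalk_to_apath)
  have ur: "u \<notin> set (awalk_verts a ?r)"
    using u set_awalk_verts_awalk_to_apath[OF walk] by blast
  have "(b, u) \<in> parcs G" using arcs(2) by (rule arcs_symmetric)
  then have w: "awalk u ((u, a) # ?r @ [(b, u)]) u"
    using arcs r by (auto simp: awalk_simps apath_def wellformed')
  have w': "awalk a (?r @ [(b, u)]) u" using w by (auto simp: awalk_Cons_iff)
  have "awalk_verts a (?r @ [(b, u)]) = awalk_verts a ?r @ [u]"
    using awalk_verts_append[OF w'] by simp
  then have "cycle ((u, a) # ?r @ [(b, u)])"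
    using w r ur by (auto simp: cycle_def apath_def intro!: exI[of _ u])
  moreover have "?r \<noteq> []" using r \<open>a \<noteq> b\<close> by (auto simp: apath_Nil_iff)
  ultimately show False using no_long_cycle by (cases ?r) force+
qed

text \<open>Induction along the first path. If the first arcs differed, following the rest of one
  path to \<open>v\<close> and the other one back would join two neighbours of \<open>u\<close>
  while avoiding \<open>u\<close>.\<close>

lemma apath_unique:
  assumes "apath u p v" "apath u q v"
  shows "p = q"
  using assms
proof (induction p arbitrary: u q)
  case Nil
  then show ?case by (metis apath_ends)
next
  case (Cons e p')
  then obtain f q' where q: "q = f # q'" by (cases q) (auto dest: apath_ends)
  have e: "e \<in> parcs G" "fst e = u" "apath (snd e) p' v" "u \<notin> set (awalk_verts (snd e) p')"
    using Cons.prems(1) by (auto simp: apath_Cons_iff)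
  have f: "f \<in> parcs G" "fst f = u" "apath (snd f) q' v" "u \<notin> set (awalk_verts (snd f) q')"
    using Cons.prems(2) q by (auto simp: apath_Cons_iff)
  have "snd e = snd f"
  proof (rule ccontr)
    assume ne: "snd e \<noteq> snd f"
    have w: "awalk (snd e) p' v" "awalk v (rev_path q') (snd f)"
      using e(3) f(3) by (auto simp: apath_def)
    have "awalk (snd e) (p' @ rev_path q') (snd f)"
      using w by (rule awalk_appendI)
    then have "u \<in> set (awalk_verts (snd e) (p' @ rev_path q'))"
      using walk_between_nbrs[OF _ _ ne] e(1,2) f(1,2) by (metis prod.collapse)
    moreover have "awalk_verts v (rev_path q') = rev (awalk_verts (snd f) q')"
      using f(3) by (intro awalk_verts_rev_path awalkI_apath)
    ultimately show False using set_awalk_verts_append[OF w] e(4) f(4) by simp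
  qed
  then show ?case using Cons.IH[OF e(3)] f(3) e(2) f(2) q by (auto simp: prod_eq_iff)
qed

section \<open>Detour distance as a metric\<close>

lemma apath_exists:
  assumes "x \<in> pverts G" "y \<in> pverts G"
  obtains p where "apath x p y"
  using assms strongly_connected unfolding strongly_connected_def
  by (auto simp: reachable_apath)

lemma apath_in_verts:
  assumes "apath x p y"
  shows "x \<in> pverts G" "y \<in> pverts G"
  using assms by (auto simp: apath_def)

lemma apath_singleton_set:
  assumes "apath x p y"
  shows "{length q |q. apath x q y} = {length p}"
  using assms apath_unique by blast

text \<open>With only one path available, the longest and the shortest length coincide.\<close>

lemma d_apath: "apath x p y \<Longrightarrow> d x y = length p"
  and graph_dist_apath: "apath x p y \<Longrightarrow> graph_dist G x y = length p"
  by (auto simp: detour_dist_def graph_dist_def apath_singleton_set)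

lemma graph_dist_eq: "x \<in> pverts G \<Longrightarrow> y \<in> pverts G \<Longrightarrow> graph_dist G x y = d x y"
  by (metis apath_exists d_apath graph_dist_apath)

text \<open>Any walk shortens to the unique path, so no walk can bypass a vertex of that
  path.\<close>

lemma apath_verts_subset_awalk_verts:
  assumes "apath x p y" "awalk x q y"
  shows "set (awalk_verts x p) \<subseteq> set (awalk_verts x q)"
  using apath_unique[OF assms(1) apath_awalk_to_apath[OF assms(2)]]
    set_awalk_verts_awalk_to_apath[OF assms(2)] by simp

text \<open>Lengths are compared by counting vertices: those of the path are distinct and all occur
  on the walk.\<close>

lemma d_le_awalk:
  assumes "awalk x q y"
  shows "d x y \<le> length q"
proof -
  let ?p = "awalk_to_apath q"
  have p: "apath x ?p y" using assms by (rule apath_awalk_to_apath)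
  have "length (awalk_verts x ?p) = card (set (awalk_verts x ?p))"
    using p by (simp add: apath_def distinct_card)
  also have "\<dots> \<le> card (set (awalk_verts x q))"
    using set_awalk_verts_awalk_to_apath[OF assms] by (intro card_mono) auto
  also have "\<dots> \<le> length (awalk_verts x q)" by (rule card_length)
  finally show ?thesis using d_apath[OF p] by (simp add: length_awalk_verts)
qed

lemma d_refl [simp]: "x \<in> pverts G \<Longrightarrow> d x x = 0"
  using d_apath[of x "[]" x] by (simp add: apath_Nil_iff)

lemma d_eq_0_iff: "x \<in> pverts G \<Longrightarrow> y \<in> pverts G \<Longrightarrow> d x y = 0 \<longleftrightarrow> x = y"
  by (metis apath_Nil_iff apath_exists d_apath d_refl length_0_conv)

lemma d_sym:
  assumes "x \<in> pverts G" "y \<in> pverts G"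
  shows "d x y = d y x"
proof -
  have "d y x \<le> d x y" if xy: "x \<in> pverts G" "y \<in> pverts G" for x y
  proof -
    obtain p where p: "apath x p y" using apath_exists[OF xy] .
    have "length (rev_path p) = length p" by (induction p) auto
    then show ?thesis using p d_apath[OF p] d_apath[of y "rev_path p" x] by simp
  qed
  then show ?thesis using assms by (simp add: order_antisym)
qed

lemma d_triangle:
  assumes "x \<in> pverts G" "y \<in> pverts G" "z \<in> pverts G"
  shows "d x z \<le> d x y + d y z"
proof -
  obtain p where p: "apath x p y" using apath_exists assms(1,2) .
  obtain q where q: "apath y q z" using apath_exists assms(2,3) .
  show ?thesis
    using d_le_awalk[OF awalk_appendI[OF p[THEN awalkI_apath] q[THEN awalkI_apath]]]
      d_apath[OF p] d_apath[OF q] by simp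
qed

section \<open>Betweenness\<close>

lemma between_sym: "between x m y \<Longrightarrow> between y m x"
  unfolding between_def by (metis apath_rev_path awalkI_apath awalk_verts_rev_path set_rev)

lemma between_in_verts:
  assumes "between x m y"
  shows "x \<in> pverts G" "m \<in> pverts G" "y \<in> pverts G"
  using assms unfolding between_def apath_def by auto

lemma between_d:
  assumes "between x m y"
  shows "d x y = d x m + d m y"
proof -
  obtain p where p: "apath x p y" "m \<in> set (awalk_verts x p)"
    using assms unfolding between_def by blast
  obtain q r where qr: "p = q @ r" "awalk x q m" "awalk m r y"
    using awalk_decomp[OF awalkI_apath[OF p(1)] p(2)] by blast
  have "awlast x q = m" using qr(2) by simp
  then have "apath x q m" "apath m r y"
    using p(1) qr(1) by (auto simp: apath_append_iff)
  then show ?thesis using d_apath p(1) qr(1) by simp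
qed

text \<open>The walk from \<open>x\<close> via \<open>v\<close> to \<open>y\<close> passes every
  vertex of the path from \<open>x\<close> to \<open>y\<close>, so \<open>m\<close> lies on one of
  its two halves.\<close>

lemma between_cases:
  assumes "between x m y" "v \<in> pverts G"
  obtains "between x m v" | "between v m y"
proof -
  obtain r where r: "apath x r y" "m \<in> set (awalk_verts x r)"
    using assms(1) unfolding between_def by blast
  obtain p where p: "apath x p v" using apath_exists between_in_verts(1)[OF assms(1)] assms(2) .
  obtain q where q: "apath v q y" using apath_exists assms(2) between_in_verts(3)[OF assms(1)] .
  have w: "awalk x p v" "awalk v q y" using p q by (auto simp: apath_def)
  have "m \<in> set (awalk_verts x p) \<union> set (awalk_verts v q)"
    using apath_verts_subset_awalk_verts[OF r(1) awalk_appendI[OF w]] r(2)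
      set_awalk_verts_append[OF w] by blast
  then show ?thesis using that p q unfolding between_def by blast
qed

section \<open>Neighbours\<close>

lemma nbrs_apath: "y \<in> nbrs G x \<Longrightarrow> apath x [(x, y)] y"
  by (auto simp: nbrs_def apath_simps wellformed' dest: no_loops')

lemma nbrs_in_verts:
  assumes "y \<in> nbrs G x"
  shows "x \<in> pverts G" "y \<in> pverts G"
  using apath_in_verts[OF nbrs_apath[OF assms]] .

lemma nbrs_sym: "y \<in> nbrs G x \<Longrightarrow> x \<in> nbrs G y"
  by (simp add: nbrs_def arcs_symmetric)

lemma d_nbrs:
  assumes "y \<in> nbrs G x"
  shows "d x y = 1" "d y x = 1"
  using d_apath[OF nbrs_apath[OF assms]] d_apath[OF nbrs_apath[OF nbrs_sym[OF assms]]] by simp_all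

lemma d_1_nbrs:
  assumes "x \<in> pverts G" "y \<in> pverts G" "d x y = 1"
  shows "y \<in> nbrs G x"
proof -
  obtain p where p: "apath x p y" using apath_exists assms(1,2) .
  then obtain e where "p = [e]" using d_apath[OF p] assms(3) by (cases p) auto
  then show ?thesis using p by (cases e) (auto simp: apath_simps nbrs_def)
qed

lemma between_nbrs:
  assumes "x \<in> nbrs G w" "y \<in> nbrs G w" "x \<noteq> y"
  shows "between x w y"
proof -
  have "apath x [(x, w), (w, y)] y"
    using assms nbrs_apath[OF nbrs_sym[OF assms(1)]] nbrs_apath[OF assms(2)]
    by (auto simp: apath_simps)
  then show ?thesis unfolding between_def by force
qed

lemma interior_vertex:
  assumes "x \<in> pverts G" "y \<in> pverts G" "d x y > 1"
  obtains m where "between x m y" "m \<noteq> x" "m \<noteq> y"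
proof -
  obtain p where p: "apath x p y" using apath_exists assms(1,2) .
  then obtain e f p' where pp: "p = e # f # p'" using d_apath[OF p] assms(3)
    by (cases p; cases "tl p") auto
  have f: "apath (snd e) (f # p') y" "e \<in> parcs G" "fst e = x"
    using p unfolding pp by (auto simp: apath_Cons_iff)
  have "snd e \<noteq> y" using apath_nonempty_ends[OF f(1)] by simp
  moreover have "snd e \<noteq> x" using f(2,3) pair_no_loops by blast
  moreover have "between x (snd e) y" unfolding between_def
    using p f(1) unfolding pp by (intro exI[of _ "e # f # p'"]) (auto simp: apath_Cons_iff)
  ultimately show ?thesis using that by blast
qed

section \<open>Eccentricity and the center\<close>

lemma verts_nonempty: "pverts G \<noteq> {}"
  using strongly_connected by (simp add: strongly_connected_def)

lemma d_le_eccentricity: "x \<in> pverts G \<Longrightarrow> v \<in> pverts G \<Longrightarrow> d x v \<le> eccentricity G x"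
  unfolding eccentricity_def using pair_finite_verts by (metis Max_ge finite_imageI graph_dist_eq imageI)

lemma eccentricity_attained:
  assumes "x \<in> pverts G"
  obtains v where "v \<in> pverts G" "eccentricity G x = d x v"
  using Max_in[of "graph_dist G x ` pverts G"] pair_finite_verts verts_nonempty
    graph_dist_eq[OF assms] that unfolding eccentricity_def by fastforce

lemma center_subset: "center G \<subseteq> pverts G"
  by (auto simp: center_def)

lemma finite_center: "finite (center G)"
  using center_subset pair_finite_verts by (rule finite_subset)

lemma center_nonempty: "center G \<noteq> {}"
proof -
  obtain x where "x \<in> pverts G" "\<And>v. v \<in> pverts G \<Longrightarrow> eccentricity G x \<le> eccentricity G v"
    using ex_min_if_finite[of "eccentricity G ` pverts G"] pair_finite_verts verts_nonempty
    by (metis arg_min_if_finite(1,2) linorder_not_less)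
  then show ?thesis by (auto simp: center_def)
qed

text \<open>An interior vertex of the path joining two central vertices would have a smaller
  eccentricity than both of them.\<close>

lemma center_nbrs:
  assumes "x \<in> center G" "y \<in> center G" "x \<noteq> y"
  shows "y \<in> nbrs G x"
proof (rule ccontr)
  assume "y \<notin> nbrs G x"
  have xy: "x \<in> pverts G" "y \<in> pverts G" using assms center_subset by auto
  then have "d x y > 1"
    using d_1_nbrs[OF xy] d_eq_0_iff[OF xy] \<open>y \<notin> nbrs G x\<close> assms(3) by linarith
  then obtain m where m: "between x m y" "m \<noteq> x" "m \<noteq> y" using interior_vertex xy by metis
  have mV: "m \<in> pverts G" using between_in_verts[OF m(1)] by simp
  \<comment> \<open>For a vertex \<open>v\<close> farthest from \<open>m\<close>, the path to
    \<open>v\<close> from \<open>x\<close> or from \<open>y\<close> runs through \<open>m\<close> by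
    \<open>between_cases\<close>, and is thus longer than \<open>d m v\<close>.\<close>
  obtain v where v: "v \<in> pverts G" "eccentricity G m = d m v" using eccentricity_attained[OF mV] .
  have pos: "d x m > 0" "d y m > 0" using d_eq_0_iff xy mV m(2,3) by auto
  have ecc: "eccentricity G x \<le> eccentricity G m" "eccentricity G y \<le> eccentricity G m"
    using assms mV by (auto simp: center_def)
  from m(1) v(1) show False
  proof (cases rule: between_cases)
    case 1
    then show False
      using between_d[OF 1] pos d_le_eccentricity[OF xy(1) v(1)] ecc v(2) by linarith
  next
    case 2
    then show False
      using between_d[OF between_sym[OF 2]] pos d_le_eccentricity[OF xy(2) v(1)] ecc v(2)
      by linarith
  qed
qed

text \<open>The path between two neighbours of \<open>w\<close> runs through \<open>w\<close> and
  has length 2.\<close>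

lemma nbrs_triangle_free:
  assumes "x \<in> nbrs G w" "y \<in> nbrs G w" "x \<noteq> y"
  shows "y \<notin> nbrs G x"
  using between_d[OF between_nbrs[OF assms]] d_nbrs[OF assms(1)] d_nbrs[OF assms(2)] d_nbrs[of y x]
  by auto

text \<open>Central vertices are pairwise adjacent and a tree has no triangles, so there are at most
  two of them.\<close>

lemma center_cases:
  obtains (one) w where "center G = {w}"
  | (two) w w' where "w \<noteq> w'" "center G = {w, w'}"
proof -
  obtain w where w: "w \<in> center G" using center_nonempty by blast
  show ?thesis
  proof (cases "center G = {w}")
    case False
    then obtain w' where w': "w' \<in> center G" "w' \<noteq> w" using w by blast
    have "z = w \<or> z = w'" if "z \<in> center G" for z
      using that w w' nbrs_triangle_free[of w' w z] center_nbrs by metis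
    then have "center G = {w, w'}" using w w' by blast
    then show ?thesis using two w'(2) by metis
  qed (rule one)
qed

section \<open>Levels\<close>

lemma level_le: "z \<in> center G \<Longrightarrow> level G v \<le> d v z"
  unfolding level_def using finite_center by auto

lemma level_attained:
  obtains z where "z \<in> center G" "level G v = d v z"
  using Min_in[of "d v ` center G"] finite_center center_nonempty that
  unfolding level_def by fastforce

lemma level_center: "z \<in> center G \<Longrightarrow> level G z = 0"
  using level_le[of z z] center_subset by auto

lemma level_0_center:
  assumes "v \<in> pverts G" "level G v = 0"
  shows "v \<in> center G"
  using level_attained[of v] assms d_eq_0_iff center_subset by (metis subsetD)

lemma d_center_le_eps:
  assumes "x \<in> center G" "y \<in> center G"
  shows "d x y \<le> eps G"
proof (cases "x = y")
  case False
  then have "card (center G) \<noteq> 1" using assms by (metis card_1_singletonE singletonD)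
  then show ?thesis using d_nbrs center_nbrs[OF assms False] by (simp add: eps_def)
qed (use assms center_subset in auto)

lemma d_le_levels:
  assumes "x \<in> pverts G" "y \<in> pverts G"
  shows "d x y \<le> level G x + level G y + eps G"
proof -
  obtain z where z: "z \<in> center G" "level G x = d x z" using level_attained .
  obtain z' where z': "z' \<in> center G" "level G y = d y z'" using level_attained .
  have V: "z \<in> pverts G" "z' \<in> pverts G" using z z' center_subset by auto
  have "d x y \<le> d x z + (d z z' + d z' y)"
    using d_triangle[of x z y] d_triangle[of z z' y] assms V by linarith
  then show ?thesis
    using d_center_le_eps[OF z(1) z'(1)] z(2) z'(2) d_sym[OF assms(2) V(2)] by linarith
qed

section \<open>Distances between branches\<close>

lemma descendents_between:
  assumes "v \<in> descendents G x"
  obtains z where "z \<in> center G" "level G v = d v z" "between v x z"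
  using assms that unfolding descendents_def between_def awalk_verts_with_proj_eq by force

lemma descendents_in_verts: "v \<in> descendents G x \<Longrightarrow> v \<in> pverts G"
  by (simp add: descendents_def)

text \<open>The two betweenness relations would give \<open>d v w = d v x + 1\<close> and
  \<open>d v x = d v w + 1\<close>.\<close>

lemma not_between_beyond_nbr:
  assumes "x \<in> nbrs G w" "between v x w"
  shows "\<not> between x w v"
  using between_d[OF assms(2)] between_d[of x w v] d_nbrs[OF assms(1)] between_in_verts[OF assms(2)]
    d_sym[of x v] d_sym[of w v] by auto

text \<open>In the path from \<open>x\<close> through \<open>w\<close> to \<open>y\<close>,
  \<open>between_cases\<close> replaces the end \<open>x\<close> by \<open>a\<close> and then
  \<open>y\<close> by \<open>b\<close>. The other alternatives would put \<open>w\<close> between a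
  vertex and the root of its branch.\<close>

lemma d_different_branches:
  assumes "center G = {w}" "in_different_branches G a b"
  shows "d a b = level G a + level G b"
proof -
  obtain x y where xy: "x \<in> nbrs G w" "y \<in> nbrs G w" "x \<noteq> y"
      "a \<in> descendents G x" "b \<in> descendents G y"
    using assms unfolding in_different_branches_def branch_def by auto
  have a: "level G a = d a w" "between a x w"
    using descendents_between[OF xy(4)] assms(1) by auto
  have b: "level G b = d b w" "between b y w"
    using descendents_between[OF xy(5)] assms(1) by auto
  note V = between_in_verts[OF a(2)] between_in_verts[OF b(2)]
  have "between a w y"
    using between_cases[OF between_nbrs[OF xy(1-3)] V(1)] not_between_beyond_nbr[OF xy(1) a(2)]
    by blast
  then have "between a w b"
    using between_cases[OF _ V(4)] not_between_beyond_nbr[OF xy(2) b(2)] between_sym by blast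
  then show ?thesis using between_d a(1) b(1) d_sym V by simp
qed

text \<open>Applied to both ends of a path joining the two sides, this forces the path through the
  edge between the central vertices.\<close>

lemma central_side_between:
  assumes center: "center G = {z, z'}" "z \<noteq> z'" and "a \<in> central_side G z"
  shows "between a z z'" "level G a = d a z"
proof -
  have nb: "z' \<in> nbrs G z" using center_nbrs center by simp
  have V: "z \<in> pverts G" "z' \<in> pverts G" using center center_subset by auto
  have "between a z z' \<and> level G a = d a z"
  proof (cases "a = z")
    case True
    then show ?thesis
      using nbrs_apath[OF nb] level_center[of z] center V unfolding between_def by force
  next
    case False
    then obtain x where x: "x \<in> nbrs G z" "x \<noteq> z'" "a \<in> descendents G x"
      using assms(3) center unfolding central_side_def branch_def by auto
    have aV: "a \<in> pverts G" using x(3) by (rule descendents_in_verts)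
    have xV: "x \<in> pverts G" using nbrs_in_verts[OF x(1)] by simp
    have bt: "between x z z'" using between_nbrs[OF x(1) nb x(2)] .
    obtain z0 where z0: "z0 \<in> center G" "level G a = d a z0" "between a x z0"
      using descendents_between[OF x(3)] .
    \<comment> \<open>A path from \<open>a\<close> via \<open>x\<close> to \<open>z'\<close> would
      pass \<open>z\<close> and have length \<open>d a x + 2\<close>, while \<open>z\<close> is
      within \<open>d a x + 1\<close>; so \<open>z'\<close> cannot be nearest.\<close>
    have "z0 \<noteq> z'"
    proof
      assume "z0 = z'"
      then have "d a z' = d a x + (1 + d z z')" "d a z' \<le> d a z"
        using between_d[OF z0(3)] between_d[OF bt] d_nbrs[OF x(1)] level_le[of z a] z0(2) center
        by auto
      then show False using d_triangle[OF aV xV V(1)] d_nbrs[OF x(1)] d_nbrs[OF nb] by linarith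
    qed
    then have z0z: "z0 = z" using z0(1) center by simp
    have "between a z z'"
      using between_cases[OF bt aV] not_between_beyond_nbr[OF x(1)] z0(3) z0z by blast
    then show ?thesis using z0(2) z0z by simp
  qed
  then show "between a z z'" "level G a = d a z" by auto
qed

lemma d_opposite_branches:
  assumes center: "center G = {w, w'}" "w \<noteq> w'" and opp: "in_opposite_branches G a b"
  shows "d a b = level G a + level G b + 1"
proof -
  obtain z z' where z: "center G = {z, z'}" "z \<noteq> z'" "a \<in> central_side G z" "b \<in> central_side G z'"
    using opp center unfolding in_opposite_branches_def by (auto simp: insert_commute)
  have a: "between a z z'" "level G a = d a z" using central_side_between[OF z(1,2,3)] .
  have "center G = {z', z}" "z' \<noteq> z" using z(1,2) by auto
  note b = central_side_between[OF this z(4)]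
  note V = between_in_verts[OF a(1)] between_in_verts[OF b(1)]
  have nb: "z' \<in> nbrs G z" using center_nbrs z by simp
  \<comment> \<open>Seen from \<open>b\<close>, the vertex \<open>z'\<close> comes one step before
    \<open>z\<close>. This excludes the second alternative when \<open>between_cases\<close>
    replaces the end \<open>z'\<close> by \<open>b\<close>.\<close>
  have "\<not> between b z z'"
    using between_d[of b z z'] between_d[OF b(1)] d_nbrs[OF nb] by auto
  then have "between a z b" using between_cases[OF a(1) V(4)] by blast
  then have "d a b = d a z + d z b" by (rule between_d)
  then show ?thesis
    using between_d[OF between_sym[OF b(1)]] d_nbrs[OF nb] a(2) b(2) d_sym V by simp
qed

section \<open>The lower bound\<close>

lemma eps'_le_end_levels:
  assumes "x \<in> pverts G" "y \<in> pverts G" "x \<noteq> y"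
  shows "eps' G \<le> level G x + level G y"
proof (cases rule: center_cases)
  \<comment> \<open>Only a central vertex has level 0, and two distinct vertices cannot both be
    \<open>w\<close>. With two central vertices, \<open>eps'\<close> is 0.\<close>
  case (one w)
  then have "x \<notin> center G \<or> y \<notin> center G" using assms(3) by auto
  then have "level G x \<noteq> 0 \<or> level G y \<noteq> 0"
    using level_0_center[OF assms(1)] level_0_center[OF assms(2)] by blast
  then show ?thesis by (auto simp: eps'_def)
qed (simp add: eps'_def eps_def)

text \<open>Here \<open>m\<close> is the order minus 1. The end levels stay explicit because the
  identity serves twice: they are estimated for an arbitrary coloring and evaluated for the given
  one.\<close>

lemma sum_gaps:
  assumes "bij_betw v {..<Suc m} (pverts G)"
  shows "(\<Sum>i<m. int m - int (level G (v i)) - int (level G (v (Suc i))) - int (eps G)) =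
    int m * (int m - int (eps G)) + int (level G (v 0)) + int (level G (v m))
      - 2 * int (total_level G)"
proof -
  let ?l = "\<lambda>i. int (level G (v i))"
  have "int (total_level G) = (\<Sum>i<Suc m. ?l i)"
    using sum.reindex_bij_betw[OF assms, of "\<lambda>x. int (level G x)"]
    by (simp add: total_level_def)
  moreover have "(\<Sum>i<m. int m - ?l i - ?l (Suc i) - int (eps G)) =
      int m * (int m - int (eps G)) - (\<Sum>i<m. ?l i + ?l (Suc i))"
    by (simp add: sum_subtractf sum.distrib algebra_simps)
  ultimately show ?thesis using sum_consecutive[of ?l m] by simp
qed

lemma hc_value_ge:
  assumes ham: "hamiltonian_coloring G c" and ord: "order G = Suc m" and "m \<ge> 1"
  shows "int m * (int m - int (eps G)) + int (eps' G) - 2 * int (total_level G)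
    \<le> int (hc_value G c)"
proof -
  obtain xs where xs: "set xs = pverts G" "distinct xs"
    using finite_distinct_list[OF pair_finite_verts] by blast
  \<comment> \<open>Enumerating the vertices by nondecreasing color removes the absolute value from
    the condition on consecutive vertices.\<close>
  define v where "v = (\<lambda>i. sort_key c xs ! i)"
  have len: "length (sort_key c xs) = Suc m"
    using xs ord distinct_card[of xs] by (simp add: order_def)
  have bij: "bij_betw v {..<Suc m} (pverts G)"
    using bij_betw_nth[of "sort_key c xs" "{..<Suc m}" "pverts G"] xs len
    unfolding v_def by simp
  have V: "v i \<in> pverts G" if "i \<le> m" for i
    using bij that by (auto dest: bij_betwE)
  have ne: "v i \<noteq> v j" if "i \<le> m" "j \<le> m" "i \<noteq> j" for i j
    using bij that unfolding bij_betw_def by (auto dest: inj_onD)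
  have step: "int m - int (level G (v i)) - int (level G (v (Suc i))) - int (eps G)
      \<le> int (c (v (Suc i))) - int (c (v i))" if "i < m" for i
  proof -
    have "map c (sort_key c xs) ! i \<le> map c (sort_key c xs) ! Suc i"
      using that len by (intro sorted_nth_mono) auto
    then have "c (v i) \<le> c (v (Suc i))" using that len by (simp add: v_def)
    moreover have "int m \<le> int (d (v i) (v (Suc i))) + \<bar>int (c (v i)) - int (c (v (Suc i)))\<bar>"
      using ham V ne that ord unfolding hamiltonian_coloring_def by fastforce
    ultimately show ?thesis using d_le_levels[of "v i" "v (Suc i)"] V that by fastforce
  qed
  have "int m * (int m - int (eps G)) + int (eps' G) - 2 * int (total_level G) \<le>
      (\<Sum>i<m. int m - int (level G (v i)) - int (level G (v (Suc i))) - int (eps G))"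
    \<comment> \<open>\<open>m \<ge> 1\<close> makes \<open>v 0\<close> and \<open>v m\<close>
      distinct, as the estimate of the end levels requires.\<close>
    using sum_gaps[OF bij] eps'_le_end_levels[of "v 0" "v m"] V ne \<open>m \<ge> 1\<close> by force
  also have "\<dots> \<le> (\<Sum>i<m. int (c (v (Suc i))) - int (c (v i)))"
    using step by (intro sum_mono) auto
  also have "\<dots> = int (c (v m)) - int (c (v 0))"
    by (rule sum_lessThan_telescope)
  also have "\<dots> \<le> int (c (v m))" by simp
  also have "\<dots> \<le> int (hc_value G c)"
    unfolding hc_value_def using V[of m] pair_finite_verts by simp
  finally show ?thesis .
qed

section \<open>Colorings from an order with short steps\<close>

lemma hamiltonian_coloring_of_order:
  assumes ord: "order G = Suc m" and "m \<ge> 3"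
    and bij: "bij_betw u {..<Suc m} (pverts G)"
    and gap: "\<And>i. i < m \<Longrightarrow> int m - int (d (u i) (u (Suc i))) \<le> int (c (u (Suc i))) - int (c (u i))"
    and incr: "\<And>i. i < m \<Longrightarrow> c (u i) \<le> c (u (Suc i))"
    and half: "\<And>i. i < m \<Longrightarrow> 2 * d (u i) (u (Suc i)) \<le> Suc m"
  shows "hamiltonian_coloring G c"
proof -
  have mono: "c (u i) \<le> c (u j)" if "i \<le> j" "j \<le> m" for i j
    using that
  proof (induction rule: dec_induct)
    case (step k)
    then show ?case using incr[of k] by simp
  qed simp
  have main: "int (d (u i) (u j)) + (int (c (u j)) - int (c (u i))) \<ge> int m"
    if ij: "i < j" "j \<le> m" for i j
  proof -
    have "u i \<in> pverts G" "u j \<in> pverts G" "u i \<noteq> u j"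
      using bij ij unfolding bij_betw_def by (auto dest: inj_onD)
    then have pos: "d (u i) (u j) \<ge> 1" using d_eq_0_iff by force
    consider "j = Suc i" | "j = Suc (Suc i)" | "j \<ge> i + 3" using ij by linarith
    then show ?thesis
    proof cases
      case 1
      then show ?thesis using gap[of i] ij by simp
    next
      \<comment> \<open>The two distances add up to at most \<open>m + 1\<close>, so the colors
        differ by at least \<open>m - 1\<close>; the missing 1 is the distance of the distinct
        vertices.\<close>
      case 2
      then show ?thesis
        using gap[of i] gap[of "Suc i"] half[of i] half[of "Suc i"] ij pos by simp
    next
      \<comment> \<open>Three steps raise the color by at least \<open>3 * (m - 1) / 2\<close>,
        which reaches \<open>m\<close> exactly when \<open>m \<ge> 3\<close>; monotonicity covers
        all later \<open>j\<close>.\<close>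
      case 3
      then have "c (u (Suc (Suc (Suc i)))) \<le> c (u j)" using ij by (intro mono) auto
      then show ?thesis
        using gap[of i] gap[of "Suc i"] gap[of "Suc (Suc i)"]
          half[of i] half[of "Suc i"] half[of "Suc (Suc i)"] ij 3 \<open>m \<ge> 3\<close> by linarith
    qed
  qed
  show ?thesis
    unfolding hamiltonian_coloring_def
  proof (intro ballI impI)
    fix x y assume xy: "x \<in> pverts G" "y \<in> pverts G" "x \<noteq> y"
    have "pverts G = u ` {..<Suc m}" using bij by (simp add: bij_betw_def)
    then obtain i j where ij: "i \<le> m" "j \<le> m" "x = u i" "y = u j"
      using xy(1,2) by (auto simp del: lessThan_Suc simp: less_Suc_eq_le)
    have "i \<noteq> j" using ij xy(3) by auto
    then consider "i < j" | "j < i" by linarith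
    then show "int (order G) - 1 \<le> int (d x y) + \<bar>int (c x) - int (c y)\<bar>"
    proof cases
      case 1
      then show ?thesis using main[of i j] ij ord by simp
    next
      case 2
      then show ?thesis using main[of j i] ij ord d_sym[OF xy(1,2)] by simp
    qed
  qed
qed

end

section \<open>Optimality of the given coloring\<close>

lemma simple_tree_if_undirected_tree:
  assumes "undirected_tree T"
  shows "simple_tree T"
proof -
  interpret pair_graph T using assms by (simp add: undirected_tree_def)
  show ?thesis
    using assms symmetric_connected_imp_strongly_connected[OF pair_sym_arcs]
    by unfold_locales (auto simp: undirected_tree_def not_le)
qed


theorem theorem5:
  fixes T :: "'a pair_pre_digraph"
    and n :: nat
    and u :: "nat \<Rightarrow> 'a"
    and c :: "'a \<Rightarrow> nat"
  assumes tree: "undirected_tree T"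
    and order: "order T = n" "n \<ge> 4"
    and max_degree: "max_degree T \<ge> 3"
    and enum: "bij_betw u {..<n} (pverts T)"
    and c_0: "c (u 0) = 0"
    and c_Suc: "\<And>i. i \<le> n - 2 \<Longrightarrow>
      int (c (u (i + 1))) = int (c (u i)) + int n - 1
        - int (level T (u i)) - int (level T (u (i + 1))) - int (eps T)"
    and c_increasing: "\<And>i. i \<le> n - 2 \<Longrightarrow> c (u i) < c (u (i + 1))"
    and ends_one: "\<And>w. center T = {w} \<Longrightarrow> u 0 = w \<and> u (n - 1) \<in> nbrs T w"
    and ends_two: "\<And>w w'. w \<noteq> w' \<Longrightarrow> center T = {w, w'} \<Longrightarrow> {u 0, u (n - 1)} = {w, w'}"
    and different: "\<And>w i. center T = {w} \<Longrightarrow> 1 \<le> i \<Longrightarrow> i \<le> n - 2 \<Longrightarrow>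
      in_different_branches T (u i) (u (i + 1))"
    and opposite: "\<And>w w' i. w \<noteq> w' \<Longrightarrow> center T = {w, w'} \<Longrightarrow> i \<le> n - 2 \<Longrightarrow>
      in_opposite_branches T (u i) (u (i + 1))"
    and dist_half: "\<And>i. i \<le> n - 2 \<Longrightarrow> real (detour_dist T (u i) (u (i + 1))) \<le> real n / 2"
  shows "int (hc T) =
           (int n - 1) * (int n - 1 - int (eps T)) + int (eps' T) - 2 * int (total_level T)
         \<and> hamiltonian_coloring T c \<and> hc_value T c = hc T"
proof -
  interpret simple_tree T using tree by (rule simple_tree_if_undirected_tree)
  define m where "m = n - 1"
  have n: "n = Suc m" "m \<ge> 3" using \<open>n \<ge> 4\<close> by (auto simp: m_def)
  have ord: "Defs.order T = Suc m" using order n by simp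
  have bij: "bij_betw u {..<Suc m} (pverts T)" using enum n by simp
  have V: "u i \<in> pverts T" if "i \<le> m" for i
    using bij that by (auto dest: bij_betwE)
  have le: "i \<le> n - 2" if "i < m" for i
    using that n by linarith
  have gap: "int (c (u (Suc i))) - int (c (u i)) =
      int m - int (level T (u i)) - int (level T (u (Suc i))) - int (eps T)" if "i < m" for i
    using c_Suc[OF le[OF that]] by (simp add: n)
  have dist: "level T (u i) + level T (u (Suc i)) + eps T \<le> d (u i) (u (Suc i))" if "i < m" for i
  proof (cases rule: center_cases)
    case (one w)
    show ?thesis
    proof (cases "i = 0")
      \<comment> \<open>The branch condition starts at index 1. Here \<open>u 0\<close> is the
        center itself, so the level of \<open>u 1\<close> is at most its distance to
        \<open>u 0\<close>.\<close>
      case True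
      have "u 0 = w" using ends_one[OF one] by simp
      then have "level T (u 0) = 0" "level T (u 1) \<le> d (u 1) (u 0)"
        using level_center level_le one by auto
      then show ?thesis using True one d_sym[of "u 0" "u 1"] V that by (simp add: eps_def)
    next
      case False
      then show ?thesis
        using d_different_branches[OF one different[OF one _ le[OF that]]] one
        by (simp add: eps_def)
    qed
  next
    case (two w w')
    then show ?thesis
      using d_opposite_branches[OF two(2,1) opposite[OF two(1,2) le[OF that]]]
      by (simp add: eps_def)
  qed
  \<comment> \<open>The conditions on the two ends are what turns \<open>eps'_le_end_levels\<close>
    into an equality.\<close>
  have ends: "level T (u 0) + level T (u m) = eps' T"
  proof (cases rule: center_cases)
    case (one w)
    then have u: "u 0 = w" "u m \<in> nbrs T w" using ends_one[OF one] n by auto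
    have "u m \<noteq> w" using d_nbrs[OF u(2)] nbrs_in_verts[OF u(2)] by auto
    then have "level T (u m) \<noteq> 0" using level_0_center[OF V] one by blast
    moreover have "level T (u m) \<le> 1" using level_le[of w "u m"] d_nbrs[OF u(2)] one by simp
    ultimately show ?thesis using level_center[of w] one u by (simp add: eps'_def eps_def)
  next
    case (two w w')
    then have "u 0 \<in> center T" "u m \<in> center T" using ends_two[OF two] n by auto
    then show ?thesis using two by (simp add: eps'_def eps_def level_center)
  qed
  have incr: "c (u i) \<le> c (u (Suc i))" if "i < m" for i
    using c_increasing[OF le[OF that]] by simp
  have ham: "hamiltonian_coloring T c"
  proof (rule hamiltonian_coloring_of_order[OF ord n(2) bij])
    show "int m - int (d (u i) (u (Suc i))) \<le> int (c (u (Suc i))) - int (c (u i))" if "i < m" for i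
      using gap[OF that] dist[OF that] by simp
    show "2 * d (u i) (u (Suc i)) \<le> Suc m" if "i < m" for i
    proof -
      have "real (2 * d (u i) (u (Suc i))) \<le> real (Suc m)"
        using dist_half[OF le[OF that]] by (simp add: n)
      then show ?thesis by (simp only: of_nat_le_iff)
    qed
  qed (rule incr)
  have "hc_value T c = c (u m)"
    unfolding hc_value_def
  proof (rule Max_eqI)
    have le_last: "c (u i) \<le> c (u m)" if "i \<le> m" for i
      using that by (induction rule: inc_induct) (auto intro: incr le_trans)
    have "pverts T = u ` {..<Suc m}" using bij by (simp add: bij_betw_def)
    then show "k \<le> c (u m)" if "k \<in> c ` pverts T" for k
      using that le_last by (auto simp del: lessThan_Suc simp: less_Suc_eq_le)
  qed (use V pair_finite_verts in auto)
  moreover have "int (c (u m)) = (\<Sum>i<m. int (c (u (Suc i))) - int (c (u i)))"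
    using sum_lessThan_telescope[of "\<lambda>i. int (c (u i))" m] c_0 by simp
  \<comment> \<open>The color differences equal the gaps exactly, so their sum is the lower bound of
    \<open>hc_value_ge\<close>.\<close>
  moreover have "\<dots> = int m * (int m - int (eps T)) + int (eps' T) - 2 * int (total_level T)"
    using sum_gaps[OF bij] ends by (simp add: gap)
  ultimately have val: "int (hc_value T c) =
      int m * (int m - int (eps T)) + int (eps' T) - 2 * int (total_level T)"
    by simp
  have "hc T = hc_value T c"
    unfolding hc_def
  proof (rule Least_equality)
    show "hc_value T c \<le> k" if k: "\<exists>c'. hamiltonian_coloring T c' \<and> hc_value T c' = k" for k
    proof -
      obtain c' where c': "hamiltonian_coloring T c'" "hc_value T c' = k" using k by blast
      have "int (hc_value T c) \<le> int (hc_value T c')"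
        unfolding val using n by (intro hc_value_ge[OF c'(1) ord]) simp
      then show ?thesis using c'(2) by simp
    qed
  qed (use ham in blast)
  then show ?thesis using ham val n by simp
qed

end
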